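(* Let $k$ be a field. The matrix-valued bigraded Hilbert--Poincaré series of $\Pi(F_4)$, whose $(i,j)$ entry is the series of $e_i\Pi(F_4)e_j$ (with $t$ recording path length and $s$ recording $x$-degree), is the symmetric matrix $h_{\Pi(F_4)}(s,t)=(1+t^4s)\cdot H$, where $$\begin{aligned} H_{11}&=1+t^6s^2, & H_{12}&=t(1+t^2s+t^4s^2),\\ H_{13}&=t^2(1+s)(1+t^2s), & H_{14}&=t^3s^{1/2}(1+s),\\ H_{22}&=(1+t^2)(1+t^2s+t^4s^2), & H_{23}&=t(1+s)(1+t^2)(1+t^2s),\\ H_{24}&=t^2s^{1/2}(1+s)(1+t^2), & H_{33}&=(1+s)(1+t^2+t^4)(1+t^2s),\\ H_{34}&=ts^{1/2}(1+s)(1+t^2+t^4), & H_{44}&=(1+s)(1+t^6s), \end{aligned}$$ and $H_{ji}=H_{ij}$. Moreover the total Hilbert--Poincaré series by path length is $$6+10t+14t^2+18t^3+20t^4+20t^5+20t^6+18t^7+14t^8+10t^9+6t^{10},$$ where the coefficient of $t^n$ is the dimension of the space spanned by the paths of length $n$ in $\Pi(F_4)$.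
   Context: Definition of $\Pi(F_4)$. It is the decorated preprojective algebra of the linear quiver with vertices $1,2,3,4$ decorated by $k,k,S,S$, where $S=k[x]/(x^2)$, with arrows $1\to2$, $2\to3$, $3\to4$ decorated by ${}_kk_k$, ${}_kS_S$, ${}_SS_S$ (signs in the relations may be dropped since the quiver is bipartite). Explicitly, $\Pi(F_4)$ is the $k$-algebra generated by orthogonal idempotents $e_1,\dots,e_4$ summing to $1$, arrows $\gamma_{i,i+1}\in e_i(\cdot)e_{i+1}$, $\gamma_{i+1,i}\in e_{i+1}(\cdot)e_i$ for $i=1,2,3$, and elements $x_3\in e_3(\cdot)e_3$, $x_4\in e_4(\cdot)e_4$ (products of paths read left to right), with relations - $x_3^2=x_4^2=0$, $x_3\gamma_{3,4}=\gamma_{3,4}x_4$, $x_4\gamma_{4,3}=\gamma_{4,3}x_3$; - $\gamma_{1,2}\gamma_{2,1}=0$; - $\gamma_{2,1}\gamma_{1,2}+\gamma_{2,3}\gamma_{3,2}=0$; - $\gamma_{3,2}\gamma_{2,3}x_3+x_3\gamma_{3,2}\gamma_{2,3}+\gamma_{3,4}\gamma_{4,3}=0$; - $\gamma_{4,3}\gamma_{3,4}=0$. Gradings. Path length: arrows have length $1$, the $e_i,x_i$ have length $0$. $x$-degree: $x_3,x_4$ have degree $1$; $\gamma_{3,4},\gamma_{4,3}$ have degree $1/2$; the remaining arrows and the $e_i$ have degree $0$. The bigraded Hilbert--Poincaré series is $\sum_{a,b}\dim_k(\text{length }a,\ x\text{-degree }b)\,t^as^b$. *)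

theory Defs
  imports
    "HOL-Library.Poly_Mapping"
    "HOL-Library.Product_Plus"
    "HOL-Computational_Algebra.Formal_Power_Series"
begin

section \<open>Free associative algebras\<close>

text \<open>
  Words form a non-commutative additive monoid (concatenation), so that the convolution
  product of \<^theory>\<open>HOL-Library.Poly_Mapping\<close> makes \<open>'a word \<Rightarrow>\<^sub>0 'k\<close> the free
  associative unital \<open>'k\<close>-algebra on \<open>'a\<close>.
\<close>

datatype 'a word = Word (letters: "'a list")

instantiation word :: (type) monoid_add
begin

definition zero_word :: "'a word" where
  "0 = Word []"

definition plus_word :: "'a word \<Rightarrow> 'a word \<Rightarrow> 'a word" where
  "v + w = Word (letters v @ letters w)"

instance
  by standard (simp_all add: zero_word_def plus_word_def)

end

inductive_set two_sided_ideal :: "'r::ring_1 set \<Rightarrow> 'r set" for R :: "'r set" where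
  zero: "0 \<in> two_sided_ideal R"
| add_multiple: "p \<in> two_sided_ideal R \<Longrightarrow> r \<in> R \<Longrightarrow> p + a * r * b \<in> two_sided_ideal R"

lemma two_sided_ideal_add:
  assumes "p \<in> two_sided_ideal R" "q \<in> two_sided_ideal R"
  shows "p + q \<in> two_sided_ideal R"
  using assms(2)
proof induction
  case zero
  then show ?case using assms(1) by simp
next
  case (add_multiple q r a b)
  then show ?case
    using two_sided_ideal.add_multiple[of "p + q" R r a b] by (simp add: add.assoc)
qed

lemma two_sided_ideal_mult:
  assumes "p \<in> two_sided_ideal R"
  shows "u * p * v \<in> two_sided_ideal R"
  using assms
proof induction
  case zero
  then show ?case by (simp add: two_sided_ideal.zero)
next
  case (add_multiple p r a b)
  then show ?case
    using two_sided_ideal.add_multiple[of "u * p * v" R r "u * a" "b * v"]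
    by (simp add: algebra_simps)
qed

lemma two_sided_ideal_mult_left: "p \<in> two_sided_ideal R \<Longrightarrow> u * p \<in> two_sided_ideal R"
  using two_sided_ideal_mult[of p R u 1] by simp

lemma two_sided_ideal_mult_right: "p \<in> two_sided_ideal R \<Longrightarrow> p * v \<in> two_sided_ideal R"
  using two_sided_ideal_mult[of p R 1 v] by simp

lemma two_sided_ideal_uminus: "p \<in> two_sided_ideal R \<Longrightarrow> - p \<in> two_sided_ideal R"
  using two_sided_ideal_mult_left[of p R "- 1"] by simp


section \<open>The algebra \<open>\<Pi>(F\<^sub>4)\<close>\<close>

datatype vertex = V1 | V2 | V3 | V4

text \<open>\<open>Gij\<close> is the arrow in \<open>e\<^sub>i(\<cdot>)e\<^sub>j\<close>; products of paths are read left to right.\<close>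

datatype gen = Idem vertex | G12 | G21 | G23 | G32 | G34 | G43 | X3 | X4

fun source :: "gen \<Rightarrow> vertex" where
  "source (Idem i) = i"
| "source G12 = V1" | "source G21 = V2"
| "source G23 = V2" | "source G32 = V3"
| "source G34 = V3" | "source G43 = V4"
| "source X3 = V3" | "source X4 = V4"

fun target :: "gen \<Rightarrow> vertex" where
  "target (Idem i) = i"
| "target G12 = V2" | "target G21 = V1"
| "target G23 = V3" | "target G32 = V2"
| "target G34 = V4" | "target G43 = V3"
| "target X3 = V3" | "target X4 = V4"

definition var :: "gen \<Rightarrow> (gen word \<Rightarrow>\<^sub>0 'k::field)" where
  "var g = Poly_Mapping.single (Word [g]) 1"

definition relators :: "(gen word \<Rightarrow>\<^sub>0 'k::field) set" where
  "relators =
     {var (Idem i) * var (Idem j) - (if i = j then var (Idem i) else 0) | i j. True} \<union>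
     {var (Idem V1) + var (Idem V2) + var (Idem V3) + var (Idem V4) - 1} \<union>
     {var (Idem (source g)) * var g * var (Idem (target g)) - var g | g. True} \<union>
     {var X3 * var X3,
      var X4 * var X4,
      var X3 * var G34 - var G34 * var X4,
      var X4 * var G43 - var G43 * var X3,
      var G12 * var G21,
      var G21 * var G12 + var G23 * var G32,
      var G32 * var G23 * var X3 + var X3 * var G32 * var G23 + var G34 * var G43,
      var G43 * var G34}"

definition Pi_F4_eq :: "(gen word \<Rightarrow>\<^sub>0 'k::field) \<Rightarrow> (gen word \<Rightarrow>\<^sub>0 'k) \<Rightarrow> bool" where
  "Pi_F4_eq p q \<longleftrightarrow> p - q \<in> two_sided_ideal relators"

lemma Pi_F4_eq_refl: "Pi_F4_eq p p"
  by (simp add: Pi_F4_eq_def two_sided_ideal.zero)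

lemma Pi_F4_eq_sym: "Pi_F4_eq p q \<Longrightarrow> Pi_F4_eq q p"
  unfolding Pi_F4_eq_def by (drule two_sided_ideal_uminus) simp

lemma Pi_F4_eq_trans: "Pi_F4_eq p q \<Longrightarrow> Pi_F4_eq q r \<Longrightarrow> Pi_F4_eq p r"
  unfolding Pi_F4_eq_def by (drule (1) two_sided_ideal_add) simp

lemma equivp_Pi_F4_eq: "equivp Pi_F4_eq"
  by (intro equivpI reflpI sympI transpI) (fact Pi_F4_eq_refl, erule Pi_F4_eq_sym, erule (1) Pi_F4_eq_trans)

quotient_type (overloaded) 'k Pi_F4 = "gen word \<Rightarrow>\<^sub>0 ('k::field)" / Pi_F4_eq
  by (rule equivp_Pi_F4_eq)

lemma Pi_F4_eq_mult:
  assumes "Pi_F4_eq p p'" "Pi_F4_eq q q'"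
  shows "Pi_F4_eq (p * q) (p' * q')"
proof -
  have "(p - p') * q + p' * (q - q') \<in> two_sided_ideal relators"
    using assms unfolding Pi_F4_eq_def
    by (intro two_sided_ideal_add two_sided_ideal_mult_left two_sided_ideal_mult_right)
  then show ?thesis by (simp add: Pi_F4_eq_def algebra_simps)
qed

instantiation Pi_F4 :: (field) ring
begin

lift_definition zero_Pi_F4 :: "'a Pi_F4" is 0 .

lift_definition plus_Pi_F4 :: "'a Pi_F4 \<Rightarrow> 'a Pi_F4 \<Rightarrow> 'a Pi_F4" is "(+)"
  unfolding Pi_F4_eq_def add_diff_add by (rule two_sided_ideal_add)

lift_definition uminus_Pi_F4 :: "'a Pi_F4 \<Rightarrow> 'a Pi_F4" is uminus
  unfolding Pi_F4_eq_def minus_diff_minus by (rule two_sided_ideal_uminus)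

lift_definition minus_Pi_F4 :: "'a Pi_F4 \<Rightarrow> 'a Pi_F4 \<Rightarrow> 'a Pi_F4" is "(-)"
proof -
  fix p p' q q' :: "gen word \<Rightarrow>\<^sub>0 'a"
  assume "Pi_F4_eq p p'" "Pi_F4_eq q q'"
  then have "(p - p') + - (q - q') \<in> two_sided_ideal relators"
    unfolding Pi_F4_eq_def by (intro two_sided_ideal_add two_sided_ideal_uminus)
  then show "Pi_F4_eq (p - q) (p' - q')"
    by (simp add: Pi_F4_eq_def algebra_simps)
qed

lift_definition times_Pi_F4 :: "'a Pi_F4 \<Rightarrow> 'a Pi_F4 \<Rightarrow> 'a Pi_F4" is "(*)"
  by (rule Pi_F4_eq_mult)

instance
  by standard (transfer; simp add: Pi_F4_eq_def two_sided_ideal.zero algebra_simps)+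

end

text \<open>
  The library class \<open>ring_1\<close> would include \<open>0 \<noteq> 1\<close>; the unit is therefore kept as a constant.
\<close>

lift_definition one_Pi_F4 :: "'k::field Pi_F4" is 1 .

lemma one_Pi_F4_mult [simp]: "one_Pi_F4 * x = x" "x * one_Pi_F4 = x"
  by (transfer; simp add: Pi_F4_eq_def two_sided_ideal.zero)+

lift_definition scale_Pi_F4 :: "'k::field \<Rightarrow> 'k Pi_F4 \<Rightarrow> 'k Pi_F4" is
  "\<lambda>c p. Poly_Mapping.single 0 c * p"
  unfolding Pi_F4_eq_def right_diff_distrib[symmetric] by (rule two_sided_ideal_mult_left)

global_interpretation Pi_F4: vector_space "scale_Pi_F4 :: 'k::field \<Rightarrow> 'k Pi_F4 \<Rightarrow> 'k Pi_F4"
  defines span_Pi_F4 = Pi_F4.span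
    and dim_Pi_F4 = Pi_F4.dim
proof
  fix a b :: 'k and x y :: "'k Pi_F4"
  show "scale_Pi_F4 a (x + y) = scale_Pi_F4 a x + scale_Pi_F4 a y"
    by transfer (simp add: Pi_F4_eq_def two_sided_ideal.zero distrib_left)
  show "scale_Pi_F4 (a + b) x = scale_Pi_F4 a x + scale_Pi_F4 b x"
    by transfer (simp add: Pi_F4_eq_def two_sided_ideal.zero distrib_right single_add)
  show "scale_Pi_F4 a (scale_Pi_F4 b x) = scale_Pi_F4 (a * b) x"
    by transfer (simp add: Pi_F4_eq_def two_sided_ideal.zero mult.assoc[symmetric] mult_single)
  show "scale_Pi_F4 1 x = x"
    by transfer (simp add: Pi_F4_eq_def two_sided_ideal.zero)
qed

lift_definition word_Pi_F4 :: "gen word \<Rightarrow> 'k::field Pi_F4" is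
  "\<lambda>w. Poly_Mapping.single w 1" .

definition idem_Pi_F4 :: "vertex \<Rightarrow> 'k::field Pi_F4" where
  "idem_Pi_F4 i = word_Pi_F4 (Word [Idem i])"


section \<open>Gradings and Hilbert--Poincare series\<close>

fun gen_length :: "gen \<Rightarrow> nat" where
  "gen_length (Idem _) = 0"
| "gen_length X3 = 0" | "gen_length X4 = 0"
| "gen_length G12 = 1" | "gen_length G21 = 1"
| "gen_length G23 = 1" | "gen_length G32 = 1"
| "gen_length G34 = 1" | "gen_length G43 = 1"

fun gen_xdegree :: "gen \<Rightarrow> rat" where
  "gen_xdegree (Idem _) = 0"
| "gen_xdegree X3 = 1" | "gen_xdegree X4 = 1"
| "gen_xdegree G12 = 0" | "gen_xdegree G21 = 0"
| "gen_xdegree G23 = 0" | "gen_xdegree G32 = 0"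
| "gen_xdegree G34 = 1/2" | "gen_xdegree G43 = 1/2"

definition path_length :: "gen word \<Rightarrow> nat" where
  "path_length w = sum_list (map gen_length (letters w))"

definition xdegree :: "gen word \<Rightarrow> rat" where
  "xdegree w = sum_list (map gen_xdegree (letters w))"

definition length_component :: "nat \<Rightarrow> 'k::field Pi_F4 set" where
  "length_component n = span_Pi_F4 {word_Pi_F4 w | w. path_length w = n}"

definition bidegree_component :: "nat \<Rightarrow> rat \<Rightarrow> 'k::field Pi_F4 set" where
  "bidegree_component a b = span_Pi_F4 {word_Pi_F4 w | w. path_length w = a \<and> xdegree w = b}"

definition corner :: "vertex \<Rightarrow> vertex \<Rightarrow> 'k::field Pi_F4 set" where
  "corner i j = {idem_Pi_F4 i * x * idem_Pi_F4 j | x. True}"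

text \<open>
  A Hilbert--Poincare series in \<open>t\<close> and rational powers of \<open>s\<close> is its coefficient function on
  exponents \<open>(a, b)\<close>, standing for \<open>t\<^sup>as\<^sup>b\<close>. The argument of type \<open>'k itself\<close> selects the field.
  Note that \<open>dim\<close> is \<open>0\<close> by convention on infinite-dimensional spaces, so the series are only
  meaningful together with the finite-dimensionality of the components.
\<close>

definition hilbert_series :: "'k::field itself \<Rightarrow> vertex \<Rightarrow> vertex \<Rightarrow> nat \<times> rat \<Rightarrow> nat" where
  "hilbert_series _ i j =
     (\<lambda>(a, b). dim_Pi_F4 (corner i j \<inter> bidegree_component a b :: 'k Pi_F4 set))"

definition total_hilbert_series :: "'k::field itself \<Rightarrow> nat fps" where
  "total_hilbert_series _ = Abs_fps (\<lambda>n. dim_Pi_F4 (length_component n :: 'k Pi_F4 set))"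

definition t_var :: "nat \<times> rat \<Rightarrow>\<^sub>0 nat" where
  "t_var = Poly_Mapping.single (1, 0) 1"

definition s_var :: "nat \<times> rat \<Rightarrow>\<^sub>0 nat" where
  "s_var = Poly_Mapping.single (0, 1) 1"

definition s_half :: "nat \<times> rat \<Rightarrow>\<^sub>0 nat" where
  "s_half = Poly_Mapping.single (0, 1/2) 1"

lemma s_half_square: "s_half ^ 2 = s_var"
  by (simp add: s_half_def s_var_def power2_eq_square mult_single)

text \<open>The common factor \<open>1 + t\<^sup>4s\<close> times \<open>H\<close>, as a coefficient function.\<close>

definition h_entry :: "(nat \<times> rat \<Rightarrow>\<^sub>0 nat) \<Rightarrow> nat \<times> rat \<Rightarrow> nat" where
  "h_entry H = Poly_Mapping.lookup ((1 + t_var ^ 4 * s_var) * H)"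

end

theory Submission
  imports Defs
begin

text \<open>
  The relations have a Groebner basis with 17 elements and coefficients \<open>\<plusminus>1\<close>, which leaves 156
  normal words. They span because reduction terminates inside a finite list of words, preserving
  the bidegree. They are independent because left multiplication followed by reduction is an
  action on the free \<open>\<int>\<close>-module over the normal words which is annihilated by the relations and
  under which each normal word, applied to \<open>e\<^sub>1 + e\<^sub>2 + e\<^sub>3 + e\<^sub>4\<close>, yields itself. Since every
  normal word lies in one corner and one bidegree, the Hilbert series count normal words.
\<close>

section \<open>Words in \<open>\<Pi>(F\<^sub>4)\<close>\<close>

text \<open>Confluence of the rewriting is never proved and no diamond lemma is invoked. Spanning
  needs only that each rule follows from the relations, and independence needs only that the
  relators act as zero. Both are certified separately, and if the rules were too few, the normal
  words would be dependent and one of the finite checks would fail. The evaluations run over the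
  integers, so that one run serves every characteristic: a field enters only through
  \<open>of_int\<close>. The unit is not one path but the sum of four idempotents. This is why a
  normal word carries an idempotent at its end, and why that sum is the vector on which the action
  is started.\<close>

abbreviation path :: "gen list \<Rightarrow> 'k::field Pi_F4" where
  "path w \<equiv> word_Pi_F4 (Word w)"

lemma path_append: "path (u @ v) = path u * path v"
  by transfer (simp add: mult_single plus_word_def Pi_F4_eq_refl)

lemma path_Nil: "path [] = one_Pi_F4"
  by transfer (simp add: zero_word_def[symmetric] Pi_F4_eq_refl)

lemma path_Cons: "path (g # w) = path [g] * path w"
  using path_append[of "[g]" w] by simp

lemma poly_mapping_single_induct [case_names zero add_single]:
  fixes p :: "'a \<Rightarrow>\<^sub>0 'b::monoid_add"
  assumes "P 0" and "\<And>k c p. P p \<Longrightarrow> P (Poly_Mapping.single k c + p)"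
  shows "P p"
proof (induction p rule: update_induct)
  case (update p k c)
  then have "Poly_Mapping.update k c p = Poly_Mapping.single k c + p"
    by (intro poly_mapping_eqI) (auto simp: lookup_update lookup_add lookup_single when_def in_keys_iff)
  with update assms(2) show ?case by simp
qed (rule assms(1))

text \<open>The index 0 is neutral on both sides, so scalars are central although words do not
  commute.\<close>

lemma single_zero_commute:
  "Poly_Mapping.single 0 (c :: 'k::field) * p = p * Poly_Mapping.single (0 :: 'm::monoid_add) c"
  by (induction p rule: poly_mapping_single_induct)
    (simp_all add: mult_single mult.commute distrib_left distrib_right)

lemma scale_Pi_F4_mult_left: "scale_Pi_F4 c x * y = scale_Pi_F4 c (x * y)"
  by transfer (simp add: mult.assoc Pi_F4_eq_refl)

lemma scale_Pi_F4_mult_right: "x * scale_Pi_F4 c y = scale_Pi_F4 c (x * y)"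
proof (transfer, goal_cases)
  case (1 x c y)
  have "x * (Poly_Mapping.single 0 c * y) = Poly_Mapping.single 0 c * (x * y)"
    by (simp only: mult.assoc[symmetric] single_zero_commute[of c x])
  then show ?case by (simp add: Pi_F4_eq_refl)
qed

lemma abs_Pi_F4_single: "abs_Pi_F4 (Poly_Mapping.single (Word w) c) = scale_Pi_F4 c (path w)"
  by (simp add: scale_Pi_F4.abs_eq word_Pi_F4_def mult_single)

lemma span_paths: "(x :: 'k::field Pi_F4) \<in> span_Pi_F4 (range path)"
proof -
  have "abs_Pi_F4 p \<in> span_Pi_F4 (range path)" for p :: "gen word \<Rightarrow>\<^sub>0 'k"
  proof (induction p rule: poly_mapping_single_induct)
    case (add_single w c p)
    then show ?case
      by (cases w) (auto simp: plus_Pi_F4.abs_eq[symmetric] abs_Pi_F4_single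
          intro!: Pi_F4.span_add Pi_F4.span_scale[OF Pi_F4.span_base])
  qed (simp add: zero_Pi_F4_def[symmetric] Pi_F4.span_zero)
  from this[of "rep_Pi_F4 x"] show ?thesis
    by (simp add: Quotient_abs_rep[OF Quotient_Pi_F4])
qed

lemma span_mult_left:
  assumes "\<And>y. y \<in> S \<Longrightarrow> z * y \<in> span_Pi_F4 T" and "x \<in> span_Pi_F4 S"
  shows "z * x \<in> span_Pi_F4 T"
  using assms(2)
proof (induction rule: Pi_F4.span_induct_alt)
  case (step c x y)
  then show ?case
    by (simp add: distrib_left scale_Pi_F4_mult_right Pi_F4.span_add Pi_F4.span_scale assms(1))
qed (simp add: Pi_F4.span_zero)

lemma span_mult_right:
  assumes "\<And>y. y \<in> S \<Longrightarrow> y * z \<in> span_Pi_F4 T" and "x \<in> span_Pi_F4 S"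
  shows "x * z \<in> span_Pi_F4 T"
  using assms(2)
proof (induction rule: Pi_F4.span_induct_alt)
  case (step c x y)
  then show ?case
    by (simp add: distrib_right scale_Pi_F4_mult_left Pi_F4.span_add Pi_F4.span_scale assms(1))
qed (simp add: Pi_F4.span_zero)

lemma abs_relator: "r \<in> relators \<Longrightarrow> abs_Pi_F4 r = 0"
  using two_sided_ideal.add_multiple[OF two_sided_ideal.zero, of r relators 1 1]
  by (simp add: zero_Pi_F4_def Pi_F4.abs_eq_iff Pi_F4_eq_def)

lemma abs_var: "abs_Pi_F4 (var g) = path [g]"
  by (simp add: var_def word_Pi_F4_def)

lemmas abs_Pi_F4_simps =
  plus_Pi_F4.abs_eq[symmetric] minus_Pi_F4.abs_eq[symmetric] times_Pi_F4.abs_eq[symmetric]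
  one_Pi_F4_def[symmetric] zero_Pi_F4_def[symmetric] abs_var

section \<open>Idempotents and the end points of paths\<close>

lemma idem_mult_idem:
  "path [Idem i] * path [Idem j] = (if i = j then path [Idem i] else (0 :: 'k::field Pi_F4))"
proof -
  have "var (Idem i) * var (Idem j) - (if i = j then var (Idem i) else 0)
      \<in> (relators :: (gen word \<Rightarrow>\<^sub>0 'k) set)"
    unfolding relators_def by (intro UnI1, rule CollectI) auto
  from abs_relator[OF this] show ?thesis
    by (simp add: abs_Pi_F4_simps split: if_splits)
qed

lemma sum_idem:
  "path [Idem V1] + path [Idem V2] + path [Idem V3] + path [Idem V4] = (one_Pi_F4 :: 'k::field Pi_F4)"
proof -
  have "var (Idem V1) + var (Idem V2) + var (Idem V3) + var (Idem V4) - 1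
      \<in> (relators :: (gen word \<Rightarrow>\<^sub>0 'k) set)"
    unfolding relators_def by (rule UnI1, rule UnI1, rule UnI2) simp
  from abs_relator[OF this] show ?thesis
    by (simp add: abs_Pi_F4_simps)
qed

lemma idem_gen_idem:
  "path [Idem (source g)] * path [g] * path [Idem (target g)] = (path [g] :: 'k::field Pi_F4)"
proof -
  have "var (Idem (source g)) * var g * var (Idem (target g)) - var g
      \<in> (relators :: (gen word \<Rightarrow>\<^sub>0 'k) set)"
    unfolding relators_def by (rule UnI1, rule UnI2) blast
  from abs_relator[OF this] show ?thesis
    by (simp add: abs_Pi_F4_simps)
qed

lemma idem_mult_path:
  "path [Idem i] * path (g # w) = (if i = source g then path (g # w) else (0 :: 'k::field Pi_F4))"
proof -
  have "path [Idem i] * path (g # w) =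
      path [Idem i] * path [Idem (source g)] * path [g] * path [Idem (target g)] * (path w :: 'k Pi_F4)"
    by (subst path_Cons, subst idem_gen_idem[of g, symmetric]) (simp only: mult.assoc)
  also have "\<dots> = (if i = source g then path (g # w) else 0)"
    by (simp add: idem_mult_idem idem_gen_idem path_Cons[of g w] del: source.simps)
  finally show ?thesis .
qed

lemma path_mult_idem:
  "path (w @ [g]) * path [Idem j] = (if target g = j then path (w @ [g]) else (0 :: 'k::field Pi_F4))"
proof -
  have "path (w @ [g]) * path [Idem j] =
      path w * (path [Idem (source g)] * path [g] * (path [Idem (target g)] * (path [Idem j] :: 'k Pi_F4)))"
    by (subst path_append, subst idem_gen_idem[of g, symmetric]) (simp only: mult.assoc)
  also have "\<dots> = (if target g = j then path (w @ [g]) else 0)"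
    by (auto simp add: idem_mult_idem idem_gen_idem path_append[of w "[g]"] simp del: target.simps source.simps)
  finally show ?thesis .
qed

lemma path_mult_path_eq_0:
  assumes "target g \<noteq> source h"
  shows "path (g # h # w) = (0 :: 'k::field Pi_F4)"
proof -
  have "path (g # h # w) = path [g] * path [Idem (target g)] * (path (h # w) :: 'k Pi_F4)"
    using path_mult_idem[of "[]" g "target g", where ?'k = 'k] by (simp add: path_Cons[of g "h # w"])
  also have "\<dots> = 0"
    using assms by (simp add: mult.assoc idem_mult_path)
  finally show ?thesis .
qed

lemma F4_relations:
  defines "p \<equiv> \<lambda>g. path [g] :: 'k::field Pi_F4"
  shows "p X3 * p X3 = 0" "p X4 * p X4 = 0"
    "p X3 * p G34 = p G34 * p X4" "p X4 * p G43 = p G43 * p X3"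
    "p G12 * p G21 = 0" "p G21 * p G12 + p G23 * p G32 = 0"
    "p G32 * p G23 * p X3 + p X3 * p G32 * p G23 + p G34 * p G43 = 0"
    "p G43 * p G34 = 0"
proof -
  have "{var X3 * var X3, var X4 * var X4, var X3 * var G34 - var G34 * var X4,
      var X4 * var G43 - var G43 * var X3, var G12 * var G21, var G21 * var G12 + var G23 * var G32,
      var G32 * var G23 * var X3 + var X3 * var G32 * var G23 + var G34 * var G43,
      var G43 * var G34} \<subseteq> (relators :: (gen word \<Rightarrow>\<^sub>0 'k) set)"
    unfolding relators_def by (rule Un_upper2)
  note rels = abs_relator[OF subsetD[OF this]]
  show "p X3 * p X3 = 0" "p X4 * p X4 = 0"
    "p X3 * p G34 = p G34 * p X4" "p X4 * p G43 = p G43 * p X3"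
    "p G12 * p G21 = 0" "p G21 * p G12 + p G23 * p G32 = 0"
    "p G32 * p G23 * p X3 + p X3 * p G32 * p G23 + p G34 * p G43 = 0"
    "p G43 * p G34 = 0"
    unfolding p_def
    using rels[of "var X3 * var X3"] rels[of "var X4 * var X4"]
      rels[of "var X3 * var G34 - var G34 * var X4"] rels[of "var X4 * var G43 - var G43 * var X3"]
      rels[of "var G12 * var G21"] rels[of "var G21 * var G12 + var G23 * var G32"]
      rels[of "var G32 * var G23 * var X3 + var X3 * var G32 * var G23 + var G34 * var G43"]
      rels[of "var G43 * var G34"]
    by (simp_all only: abs_Pi_F4_simps insert_iff simp_thms eq_iff_diff_eq_0[symmetric])
qed

section \<open>Normal forms\<close>

type_synonym combination = "(int \<times> gen list) list"

definition linext :: "('a \<Rightarrow> (int \<times> 'b) list) \<Rightarrow> (int \<times> 'a) list \<Rightarrow> (int \<times> 'b) list" where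
  "linext f xs = concat (map (\<lambda>(c, v). map (\<lambda>(d, w). (c * d, w)) (f v)) xs)"

fun strip_prefix :: "'a list \<Rightarrow> 'a list \<Rightarrow> 'a list option" where
  "strip_prefix [] ys = Some ys"
| "strip_prefix (x # xs) [] = None"
| "strip_prefix (x # xs) (y # ys) = (if x = y then strip_prefix xs ys else None)"

fun first_match :: "('a list \<times> 'b) list \<Rightarrow> 'a list \<Rightarrow> ('b \<times> 'a list) option" where
  "first_match [] w = None"
| "first_match ((l, r) # rs) w =
     (case strip_prefix l w of None \<Rightarrow> first_match rs w | Some u \<Rightarrow> Some (r, u))"

text \<open>
  A noncommutative Groebner basis of the relations, found by Buchberger's algorithm, where words
  of equal bidegree are compared lexicographically with
  \<open>G21 < G43 < G34 < G32 < G12 < G23 < X3 < X4\<close>. All leading coefficients are units of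
  \<open>\<int>\<close>, so it is the same over every field.
\<close>

definition rules :: "(gen list \<times> combination) list" where
  "rules =
    [([X3, X3], []),
     ([X4, X4], []),
     ([X3, G34], [(1, [G34, X4])]),
     ([X4, G43], [(1, [G43, X3])]),
     ([G43, G34], []),
     ([G12, G21], []),
     ([G23, G32], [(-1, [G21, G12])]),
     ([X3, G32, G23], [(-1, [G32, G23, X3]), (-1, [G34, G43])]),
     ([X3, G32, G21, G12], [(1, [G32, G23, X3, G32]), (1, [G34, G43, G32])]),
     ([G32, G23, X3, G32, G21], [(-1, [G34, G43, G32, G21])]),
     ([G32, G23, G34, G43, G32],
        [(1, [G32, G21, G12, G23, X3, G32]), (-1, [G34, G43, G32, G21, G12])]),
     ([G23, G34, G43, G32, G21], [(1, [G21, G12, G23, X3, G32, G21])]),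
     ([G32, G21, G12, G23, G34, G43, X3, G32, G21],
        [(-1, [G34, G43, G32, G21, G12, G23, X3, G32, G21])]),
     ([G32, G21, G12, G23, G34, G43, G32, G23, X3, G32],
        [(-1, [G34, G43, G32, G21, G12, G23, G34, G43, G32])]),
     ([G32, G21, G12, G23, G34, G43, G32, G23, G34, G43],
        [(1, [G34, G43, G32, G21, G12, G23, G34, G43, G32, G23])]),
     ([G34, G43, G32, G21, G12, G23, G34, G43, G32, G23, G34], []),
     ([G21, G12, G23, G34, G43, G32, G23, G34, G43, X3, G32, G21], [])]"

text \<open>
  \<open>lmul n g w\<close> is the normal form of \<open>g \<cdot> w\<close> for a normal word \<open>w\<close>; as \<open>w\<close> contains no leading
  word, only a prefix of \<open>g # w\<close> can. The fuel \<open>n\<close> bounds the nesting of rewrite steps.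
\<close>

fun lmul :: "nat \<Rightarrow> gen \<Rightarrow> gen list \<Rightarrow> combination" where
  "lmul 0 g w = [(1, g # w)]"
| "lmul (Suc n) g [] = [(1, [g])]"
| "lmul (Suc n) g (h # w) =
     (if target g \<noteq> source h then []
      else if g = Idem (source g) then [(1, h # w)]
      else case first_match rules (g # h # w) of
        None \<Rightarrow> [(1, g # h # w)]
      | Some (r, u) \<Rightarrow> concat (map (\<lambda>(c, v). foldr (\<lambda>k. linext (lmul n k)) v [(c, u)]) r))"

text \<open>Correctness does not rest on the number 8: exhausted fuel merely leaves a product
  unreduced. That 8 levels suffice on the normal words is part of
  \<open>closed_under_act_basis\<close>.\<close>

definition act :: "gen \<Rightarrow> gen list \<Rightarrow> combination" where
  "act g w = lmul 8 g w"

definition vertices :: "vertex list" where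
  "vertices = [V1, V2, V3, V4]"

definition arrows :: "gen list" where
  "arrows = [G12, G21, G23, G32, G34, G43, X3, X4]"

definition gens :: "gen list" where
  "gens = map Idem vertices @ arrows"

text \<open>Suffixes of normal words are normal, so extension on the left by one arrow reaches every
  normal word. Since the tail is already normal, a leading word can occur only as a prefix of the
  extension.\<close>

definition prolong :: "gen list list \<Rightarrow> gen list list" where
  "prolong ws = concat (map (\<lambda>w. map (\<lambda>g. g # w)
     (filter (\<lambda>g. target g = source (hd w) \<and> first_match rules (g # w) = None) arrows)) ws)"

primrec layers :: "nat \<Rightarrow> gen list list \<Rightarrow> gen list list" where
  "layers 0 ws = []"
| "layers (Suc n) ws = ws @ layers n (prolong ws)"

text \<open>Normal words carry the idempotent of their end point as last letter.\<close>

definition basis :: "gen list list" where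
  "basis = layers 12 (map (\<lambda>v. [Idem v]) vertices)"

text \<open>The relators as integral data, fit for evaluation and independent of the field; the
  empty word stands for the unit. The link to \<open>relators\<close> is
  \<open>relators_subset\<close>.\<close>

definition relator_list :: "combination list" where
  "relator_list =
     concat (map (\<lambda>i. map (\<lambda>j. (1, [Idem i, Idem j]) # (if i = j then [(-1, [Idem i])] else []))
       vertices) vertices) @
     [(-1, []) # map (\<lambda>v. (1, [Idem v])) vertices] @
     map (\<lambda>g. [(1, [Idem (source g), g, Idem (target g)]), (-1, [g])]) gens @
     [[(1, [X3, X3])],
      [(1, [X4, X4])],
      [(1, [X3, G34]), (-1, [G34, X4])],
      [(1, [X4, G43]), (-1, [G43, X3])],
      [(1, [G12, G21])],
      [(1, [G21, G12]), (1, [G23, G32])],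
      [(1, [G32, G23, X3]), (1, [X3, G32, G23]), (1, [G34, G43])],
      [(1, [G43, G34])]]"

section \<open>The action on combinations and the finite checks\<close>

definition act_path :: "gen list \<Rightarrow> combination \<Rightarrow> combination" where
  "act_path gs xs = foldr (\<lambda>g. linext (act g)) gs xs"

definition act_combination :: "combination \<Rightarrow> gen list \<Rightarrow> combination" where
  "act_combination r w = concat (map (\<lambda>(c, gs). act_path gs [(c, w)]) r)"

definition is_null :: "combination \<Rightarrow> bool" where
  "is_null xs = list_all (\<lambda>(c, w). sum_list (map fst (filter (\<lambda>(d, v). v = w) xs)) = 0) xs"

definition closed_under_act :: "gen list list \<Rightarrow> bool" where
  "closed_under_act bs =
     list_all (\<lambda>w. list_all (\<lambda>g. list_all (\<lambda>(c, u). u \<in> set bs) (act g w)) gens) bs"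

definition relators_vanish :: "gen list list \<Rightarrow> bool" where
  "relators_vanish bs =
     list_all (\<lambda>w. list_all (\<lambda>r. is_null (act_combination r w)) relator_list) bs"

text \<open>Literal equality of lists can be demanded: the final idempotent of \<open>w\<close>
  kills three of the four summands, and on the remaining one no rule ever fires.\<close>

definition all_normal :: "gen list list \<Rightarrow> bool" where
  "all_normal bs =
     list_all (\<lambda>w. act_path w (map (\<lambda>v. (1, [Idem v])) vertices) = [(1, w)]) bs"

text \<open>This certifies two numbers at once: fuel 8 reduces every product completely, and 12
  layers exhaust the normal words, because a further one would appear as a product
  \<open>g # w\<close> outside the list.\<close>

lemma closed_under_act_basis: "closed_under_act basis"
  by code_simp

text \<open>This finite check takes the place of resolving the overlaps of the rules.\<close>

lemma relators_vanish_basis: "relators_vanish basis"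
  by code_simp

lemma all_normal_basis: "all_normal basis"
  by code_simp

lemma distinct_basis: "distinct basis"
  by code_simp

lemma nonempty_basis: "list_all (\<lambda>w. w \<noteq> []) basis"
  by code_simp

section \<open>The rewrite rules hold in \<open>\<Pi>(F\<^sub>4)\<close>\<close>

text \<open>
  Each derived rule comes from the two ways of reducing an overlap of two earlier leading words;
  the equation starting each step below is that overlap.
\<close>

lemma F4_consequences:
  fixes a A b B c C x y :: "'r::ring"
  assumes xx: "x * x = 0" and yy: "y * y = 0" and xc: "x * c = c * y" and yC: "y * C = C * x"
    and aA: "a * A = 0" and AabB: "A * a + b * B = 0"
    and Bbx: "B * b * x + x * B * b + c * C = 0" and Cc: "C * c = 0"
  shows "b * B = - (A * a)"
    and "x * (B * b) = - (B * (b * x)) - c * C"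
    and "x * (B * (A * a)) = B * (b * (x * B)) + c * (C * B)"
    and "B * (b * (x * (B * A))) = - (c * (C * (B * A)))"
    and "B * (b * (c * (C * B))) = B * (A * (a * (b * (x * B)))) - c * (C * (B * (A * a)))"
    and "b * (c * (C * (B * A))) = A * (a * (b * (x * (B * A))))"
    and "B * (A * (a * (b * (c * (C * (x * (B * A))))))) =
      - (c * (C * (B * (A * (a * (b * (x * (B * A))))))))"
    and "B * (A * (a * (b * (c * (C * (B * (b * (x * B)))))))) =
      - (c * (C * (B * (A * (a * (b * (c * (C * B))))))))"
    and "B * (A * (a * (b * (c * (C * (B * (b * (c * C)))))))) =
      c * (C * (B * (A * (a * (b * (c * (C * (B * b))))))))"
    and "c * (C * (B * (A * (a * (b * (c * (C * (B * (b * c))))))))) = 0"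
    and "A * (a * (b * (c * (C * (B * (b * (c * (C * (x * (B * A)))))))))) = 0"
proof -
  \<comment> \<open>Products are kept nested to the right, where a relation matches only a complete
    tail. Each rule is therefore also supplied multiplied by an arbitrary right factor
    \<open>z\<close>; the variants differ in the length of the left side.\<close>
  have ext: "u * (v * z) = w * z" if "u * v = w" for u v w z :: 'r
    using that by (simp add: mult.assoc[symmetric])
  have ext3: "u * (v * (r * z)) = w * z" if "u * (v * r) = w" for u v w r z :: 'r
    using that by (simp add: mult.assoc[symmetric])
  have ext4: "u * (v * (r * (s * z))) = w * z" if "u * (v * (r * s)) = w" for u v w r s z :: 'r
    using that by (simp add: mult.assoc[symmetric])
  have ext5: "u * (v * (r * (s * (q * z)))) = w * z" if "u * (v * (r * (s * q))) = w"
    for u v w r s q z :: 'r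
    using that by (simp add: mult.assoc[symmetric])
  note norm = mult.assoc left_diff_distrib right_diff_distrib distrib_left distrib_right

  show bB: "b * B = - (A * a)"
    using AabB by (simp add: eq_neg_iff_add_eq_0 add.commute)
  show xBb: "x * (B * b) = - (B * (b * x)) - c * C"
    using Bbx by (simp add: mult.assoc algebra_simps eq_neg_iff_add_eq_0)
  note r1 = xx yy xc yC aA bB xBb Cc
    ext[OF xx] ext[OF yy] ext[OF xc] ext[OF yC] ext[OF aA] ext[OF bB] ext3[OF xBb] ext[OF Cc]

  have "(x * (B * b)) * B = x * (B * (b * B))"
    by (simp only: mult.assoc)
  then show xBAa: "x * (B * (A * a)) = B * (b * (x * B)) + c * (C * B)"
    unfolding xBb bB by (simp add: norm algebra_simps)
  note r2 = r1 xBAa ext4[OF xBAa]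

  have "(x * (B * (A * a))) * A = x * (B * (A * (a * A)))"
    by (simp only: mult.assoc)
  then show BbxBA: "B * (b * (x * (B * A))) = - (c * (C * (B * A)))"
    unfolding xBAa aA by (simp add: norm eq_neg_iff_add_eq_0)
  note r3 = r2 BbxBA ext5[OF BbxBA]

  have "(x * (B * (A * a))) * (b * B) = x * (B * (A * (a * (b * B))))"
    by (simp only: mult.assoc)
  then show BbcCB: "B * (b * (c * (C * B))) = B * (A * (a * (b * (x * B)))) - c * (C * (B * (A * a)))"
    by (simp add: norm r3 algebra_simps)
  note r4 = r3 BbcCB ext5[OF BbcCB]

  have "(b * B) * (b * (x * (B * A))) = b * (B * (b * (x * (B * A))))"
    by (simp only: mult.assoc)
  then show bcCBA: "b * (c * (C * (B * A))) = A * (a * (b * (x * (B * A))))"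
    unfolding bB BbxBA by (simp add: norm)
  note r5 = r4 bcCBA ext5[OF bcCBA]

  have "(B * (b * (c * (C * B)))) * (b * (x * (B * A))) = B * (b * (c * (C * (B * (b * (x * (B * A)))))))"
    by (simp only: mult.assoc)
  then show BAabcCxBA: "B * (A * (a * (b * (c * (C * (x * (B * A))))))) =
      - (c * (C * (B * (A * (a * (b * (x * (B * A))))))))"
    unfolding BbcCB BbxBA
    by (simp add: norm r5 algebra_simps neg_eq_iff_add_eq_0 eq_neg_iff_add_eq_0)

  have "(B * (b * (c * (C * B)))) * (b * (c * (C * B))) = B * (b * (c * (C * (B * (b * (c * (C * B)))))))"
    by (simp only: mult.assoc)
  then show BAabcCBbxB: "B * (A * (a * (b * (c * (C * (B * (b * (x * B)))))))) =
      - (c * (C * (B * (A * (a * (b * (c * (C * B))))))))"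
    unfolding BbcCB by (simp add: norm r5 algebra_simps eq_neg_iff_add_eq_0)

  have "(B * (A * (a * (b * (c * (C * (B * (b * (x * B))))))))) * b =
      B * (A * (a * (b * (c * (C * (B * (b * (x * (B * b)))))))))"
    by (simp only: mult.assoc)
  then show BAabcCBbcC: "B * (A * (a * (b * (c * (C * (B * (b * (c * C)))))))) =
      c * (C * (B * (A * (a * (b * (c * (C * (B * b))))))))"
    unfolding BAabcCBbxB by (simp add: norm r5 algebra_simps eq_neg_iff_add_eq_0)

  \<comment> \<open>The right bracketing contains \<open>C * c = 0\<close>, so the other reduct must
    vanish: this is how a rule with right side 0 arises.\<close>
  have "(B * (A * (a * (b * (c * (C * (B * (b * (c * C))))))))) * c =
      B * (A * (a * (b * (c * (C * (B * (b * (c * (C * c)))))))))"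
    by (simp only: mult.assoc)
  then show cCBAabcCBbc: "c * (C * (B * (A * (a * (b * (c * (C * (B * (b * c))))))))) = 0"
    unfolding BAabcCBbcC Cc by (simp add: norm)

  have "(b * (c * (C * (B * A)))) * (a * (b * (c * (C * (x * (B * A)))))) =
      b * (c * (C * (B * (A * (a * (b * (c * (C * (x * (B * A))))))))))"
    by (simp only: mult.assoc)
  then show "A * (a * (b * (c * (C * (B * (b * (c * (C * (x * (B * A)))))))))) = 0"
    unfolding BAabcCxBA bcCBA by (simp add: norm r5)
qed

section \<open>Soundness of the reduction\<close>

definition eval :: "combination \<Rightarrow> 'k::field Pi_F4" where
  "eval xs = (\<Sum>(c, w)\<leftarrow>xs. scale_Pi_F4 (of_int c) (path w))"

lemma eval_simps [simp]:
  "eval [] = 0"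
  "eval ((c, w) # xs) = scale_Pi_F4 (of_int c) (path w) + eval xs"
  "eval (xs @ ys) = eval xs + eval ys"
  by (simp_all add: eval_def)

text \<open>The letters \<open>a\<close>, \<open>b\<close>, \<open>c\<close> of
  \<open>F4_consequences\<close> become \<open>G12\<close>, \<open>G23\<close>, \<open>G34\<close>,
  the capitals become the reversed arrows, and \<open>x\<close>, \<open>y\<close> become
  \<open>X3\<close>, \<open>X4\<close>.\<close>

lemma path_eq_eval_rule:
  assumes "(l, r) \<in> set rules"
  shows "path l = (eval r :: 'k::field Pi_F4)"
proof -
  note F4 = F4_relations[where ?'k = 'k]
  \<comment> \<open>The restriction to tails with at least one letter keeps \<open>path_Cons\<close>
    from splitting a one-letter path for ever.\<close>
  note paths = path_Cons[of _ "_ # _"]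
  show ?thesis
    using assms unfolding rules_def
    by (auto simp: paths F4 F4_consequences[OF F4])
qed

abbreviation words :: "combination \<Rightarrow> gen list set" where
  "words xs \<equiv> snd ` set xs"

lemma linext_Nil [simp]: "linext f [] = []"
  by (simp add: linext_def)

lemma linext_Cons [simp]:
  "linext f ((c, v) # xs) = map (\<lambda>(d, w). (c * d, w)) (f v) @ linext f xs"
  by (simp add: linext_def)

lemma words_scale [simp]: "words (map (\<lambda>(d, w). (c * d, w)) xs) = words xs"
  by (induction xs) auto

lemma words_linext [simp]: "words (linext f xs) = (\<Union>v\<in>words xs. words (f v))"
proof (induction xs)
  case (Cons a xs)
  obtain c v where "a = (c, v)" by (cases a)
  with Cons show ?case
    by (simp only: linext_Cons set_append image_Un words_scale) simp
qed simp

lemma eval_scale: "eval (map (\<lambda>(d, w). (c * d, w)) xs) = scale_Pi_F4 (of_int c) (eval xs)"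
  by (induction xs) (auto simp: Pi_F4.scale_right_distrib)

lemma eval_linext:
  assumes "\<And>v. eval (f v) = z * path v"
  shows "eval (linext f xs) = z * eval xs"
  by (induction xs) (auto simp: assms eval_scale scale_Pi_F4_mult_right distrib_left)

lemma eval_in_span: "(eval xs :: 'k::field Pi_F4) \<in> span_Pi_F4 (path ` words xs)"
proof (induction xs)
  case (Cons a xs)
  have "(eval xs :: 'k Pi_F4) \<in> span_Pi_F4 (path ` words (a # xs))"
    by (rule subsetD[OF Pi_F4.span_mono Cons.IH]) auto
  then show ?case
    by (cases a) (auto intro!: Pi_F4.span_add Pi_F4.span_scale[OF Pi_F4.span_base])
qed (simp add: Pi_F4.span_zero)

lemma strip_prefix_Some: "strip_prefix l w = Some u \<Longrightarrow> w = l @ u"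
  by (induction l w rule: strip_prefix.induct) (auto split: if_splits)

lemma first_match_Some: "first_match rs w = Some (r, u) \<Longrightarrow> \<exists>l. (l, r) \<in> set rs \<and> w = l @ u"
  by (induction rs w rule: first_match.induct) (auto split: option.splits dest: strip_prefix_Some)

text \<open>Each branch of \<open>lmul\<close> is an identity in the algebra, so the equation holds
  for every fuel and for words \<open>w\<close> that are not normal.\<close>

lemma eval_lmul: "eval (lmul n g w) = (path (g # w) :: 'k::field Pi_F4)"
proof (induction n arbitrary: g w)
  case (Suc n)
  \<comment> \<open>After a rewrite, the letters of a right side are multiplied back one at a time
    onto the untouched rest of the word.\<close>
  have fold: "eval (foldr (\<lambda>k. linext (lmul n k)) v xs) = path v * (eval xs :: 'k Pi_F4)" for v xs
  proof (induction v)
    case (Cons k v)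
    have "eval (lmul n k u) = path [k] * (path u :: 'k Pi_F4)" for u
      using Suc.IH path_Cons by metis
    with Cons show ?case
      by (simp add: eval_linext[of _ "path [k]"] path_Cons[of k v] mult.assoc[symmetric])
  qed (simp add: path_Nil)
  have concat: "eval (concat (map (\<lambda>(c, v). foldr (\<lambda>k. linext (lmul n k)) v [(c, u)]) r)) =
      eval r * (path u :: 'k Pi_F4)" for r u
    by (induction r)
      (auto simp: fold distrib_right scale_Pi_F4_mult_left scale_Pi_F4_mult_right)
  show ?case
  proof (cases w)
    case (Cons h v)
    show ?thesis
    proof (cases "target g = source h \<and> g \<noteq> Idem (source g)")
      case True
      then show ?thesis
      proof (cases "first_match rules (g # h # v)")
        case (Some a)
        obtain r u where a: "a = (r, u)" by (cases a)
        from first_match_Some[OF Some[unfolded a]]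
        obtain l where l: "(l, r) \<in> set rules" "g # h # v = l @ u" by blast
        show ?thesis
          using True Some by (simp add: Cons a concat path_eq_eval_rule[OF l(1), symmetric]
              path_append[symmetric] l(2))
      qed (simp add: Cons)
    next
      case False
      show ?thesis
      proof (cases "target g = source h")
        case True
        with False obtain i where g: "g = Idem i" by blast
        with True have "i = source h" by simp
        then show ?thesis
          by (simp add: Cons g path_Cons[of "Idem (source h)" "h # v"] idem_mult_path)
      qed (simp add: Cons path_mult_path_eq_0)
    qed
  qed simp
qed simp

section \<open>Reduction preserves the bidegree\<close>

definition bidegree :: "gen list \<Rightarrow> nat \<times> rat" where
  "bidegree w = (path_length (Word w), xdegree (Word w))"

lemma bidegree_append: "bidegree (u @ v) = bidegree u + bidegree v"
  by (simp add: bidegree_def path_length_def xdegree_def)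

lemma bidegree_Cons: "bidegree (g # w) = bidegree [g] + bidegree w"
  using bidegree_append[of "[g]" w] by (simp only: append_Cons append_Nil)

lemma bidegree_rule: "(l, r) \<in> set rules \<Longrightarrow> v \<in> words r \<Longrightarrow> bidegree v = bidegree l"
  unfolding rules_def by (auto simp: bidegree_def path_length_def xdegree_def)

text \<open>The rules are homogeneous and idempotents have bidegree 0, so absorbing one changes
  nothing. Products that vanish contribute no words at all.\<close>

lemma bidegree_lmul: "u \<in> words (lmul n g w) \<Longrightarrow> bidegree u = bidegree (g # w)"
proof (induction n arbitrary: u g w)
  case (Suc n)
  have fold: "u \<in> words (foldr (\<lambda>k. linext (lmul n k)) v [(c, t)]) \<Longrightarrow> bidegree u = bidegree (v @ t)"
    for u v c t
  proof (induction v arbitrary: u)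
    case (Cons k v)
    from Cons.prems obtain s where s: "s \<in> words (foldr (\<lambda>k. linext (lmul n k)) v [(c, t)])"
      and u: "u \<in> words (lmul n k s)"
      by (auto simp only: foldr.simps o_apply words_linext)
    from Cons.IH[OF s] Suc.IH[OF u] show ?case
      by (simp only: bidegree_Cons[of k s] bidegree_Cons[of k "v @ t"] append_Cons)
  qed simp
  show ?case
  proof (cases w)
    case (Cons h v)
    show ?thesis
    proof (cases "target g = source h \<and> g \<noteq> Idem (source g)")
      case True
      show ?thesis
      proof (cases "first_match rules (g # h # v)")
        case None
        with True Suc.prems show ?thesis by (simp add: Cons)
      next
        case (Some a)
        obtain r t where a: "a = (r, t)" by (cases a)
        from first_match_Some[OF Some[unfolded a]]
        obtain l where l: "(l, r) \<in> set rules" "g # h # v = l @ t" by blast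
        have "u \<in> (\<Union>(c, s)\<in>set r. words (foldr (\<lambda>k. linext (lmul n k)) s [(c, t)]))"
          using True Some Suc.prems by (force simp: Cons a)
        then obtain c s where cs: "(c, s) \<in> set r" "bidegree u = bidegree (s @ t)"
          using fold by blast
        then have "bidegree s = bidegree l"
          using bidegree_rule[OF l(1), of s] by force
        with cs l(2) show ?thesis by (simp add: Cons bidegree_append)
      qed
    next
      case False
      show ?thesis
      proof (cases "target g = source h")
        case True
        with False obtain i where "g = Idem i" by blast
        with True Suc.prems show ?thesis
          by (simp add: Cons bidegree_def path_length_def xdegree_def)
      qed (use Suc.prems Cons in simp)
    qed
  qed (use Suc.prems in simp)
qed simp

section \<open>The normal words span\<close>

lemma Idem_in_basis: "[Idem v] \<in> set basis"
  by (cases v) (simp_all add: basis_def vertices_def numeral_eq_Suc)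

lemma in_gens: "g \<in> set gens"
proof (cases g)
  case (Idem v)
  then show ?thesis by (cases v) (simp_all add: gens_def vertices_def)
qed (simp_all add: gens_def arrows_def)

lemma words_act_subset: "w \<in> set basis \<Longrightarrow> words (act g w) \<subseteq> set basis"
  using closed_under_act_basis in_gens[of g]
  by (force simp: closed_under_act_def list_all_iff)

text \<open>A word is obtained from the unit by multiplying its letters on from the left. The unit
  is a sum of four normal words of bidegree 0, and each multiplication stays among normal words of
  the right bidegree. Carrying the bidegree along yields the spanning sets of all graded components
  at once.\<close>

lemma path_in_span_bidegree:
  "path w \<in> span_Pi_F4 (path ` {u \<in> set basis. bidegree u = bidegree w} :: 'k::field Pi_F4 set)"
proof (induction w)
  case Nil
  have "path [Idem v] \<in> span_Pi_F4 (path ` {u \<in> set basis. bidegree u = bidegree []} :: 'k Pi_F4 set)"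
    for v
    by (rule Pi_F4.span_base)
      (auto simp: Idem_in_basis bidegree_def path_length_def xdegree_def)
  then show ?case
    unfolding path_Nil sum_idem[symmetric] by (intro Pi_F4.span_add)
next
  case (Cons g w)
  show ?case
    unfolding path_Cons[of g w]
  proof (rule span_mult_left[OF _ Cons.IH])
    fix y :: "'k Pi_F4"
    assume "y \<in> path ` {u \<in> set basis. bidegree u = bidegree w}"
    then obtain u where u: "y = path u" "u \<in> set basis" "bidegree u = bidegree w" by blast
    have "words (act g u) \<subseteq> {v \<in> set basis. bidegree v = bidegree (g # w)}"
      using words_act_subset[OF u(2), of g] bidegree_lmul[of _ 8 g u, folded act_def]
      by (auto simp: bidegree_Cons[of g w] bidegree_Cons[of g u] u(3))
    then have "span_Pi_F4 (path ` words (act g u)) \<subseteq>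
        (span_Pi_F4 (path ` {v \<in> set basis. bidegree v = bidegree (g # w)}) :: 'k Pi_F4 set)"
      by (intro Pi_F4.span_mono image_mono)
    moreover have "path [g] * y = eval (act g u)"
      by (simp add: u(1) act_def eval_lmul path_Cons[of g u])
    ultimately show "path [g] * y \<in>
        span_Pi_F4 (path ` {v \<in> set basis. bidegree v = bidegree (g # w)})"
      using eval_in_span[of "act g u"] by auto
  qed
qed

lemma span_basis: "span_Pi_F4 (path ` set basis) = (UNIV :: 'k::field Pi_F4 set)"
proof -
  have "path w \<in> (span_Pi_F4 (path ` set basis) :: 'k Pi_F4 set)" for w
    using path_in_span_bidegree[of w, where ?'k = 'k]
    by (rule subsetD[OF Pi_F4.span_mono, rotated]) blast
  then have "span_Pi_F4 (range path) \<subseteq> (span_Pi_F4 (path ` set basis) :: 'k Pi_F4 set)"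
    by (intro Pi_F4.span_minimal) (auto simp: Pi_F4.subspace_span)
  then show ?thesis
    using span_paths[where ?'k = 'k] by blast
qed

section \<open>The normal words are independent\<close>

text \<open>
  Left multiplication of normal words is recorded as an integral action \<open>act_frag\<close>, whose
  coefficients can be read in any field.
\<close>

definition frag_list :: "combination \<Rightarrow> (gen list \<Rightarrow>\<^sub>0 int)" where
  "frag_list xs = (\<Sum>(c, w)\<leftarrow>xs. frag_cmul c (frag_of w))"

lemma frag_list_simps [simp]:
  "frag_list [] = 0"
  "frag_list ((c, w) # xs) = frag_cmul c (frag_of w) + frag_list xs"
  "frag_list (xs @ ys) = frag_list xs + frag_list ys"
  by (simp_all add: frag_list_def)

lemma frag_list_scale: "frag_list (map (\<lambda>(d, w). (c * d, w)) xs) = frag_cmul c (frag_list xs)"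
  by (induction xs) (auto simp: frag_cmul_distrib2)

lemma frag_list_linext: "frag_list (linext f xs) = frag_extend (\<lambda>w. frag_list (f w)) (frag_list xs)"
  by (induction xs) (auto simp: frag_list_scale frag_extend_add frag_extend_cmul)

lemma lookup_frag_list:
  "Poly_Mapping.lookup (frag_list xs) u = sum_list (map fst (filter (\<lambda>(d, v). v = u) xs))"
  by (induction xs) (auto simp: lookup_add lookup_single_not_eq)

lemma is_null_frag_list:
  assumes "is_null xs"
  shows "frag_list xs = 0"
proof (rule poly_mapping_eqI)
  fix u
  show "Poly_Mapping.lookup (frag_list xs) u = Poly_Mapping.lookup 0 u"
  proof (cases "u \<in> words xs")
    case True
    with assms show ?thesis
      by (auto simp: is_null_def list_all_iff lookup_frag_list)
  next
    case False
    then have "filter (\<lambda>(d, v). v = u) xs = []"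
      by (force simp: filter_empty_conv)
    then show ?thesis by (simp add: lookup_frag_list)
  qed
qed

lemma keys_frag_list: "Poly_Mapping.keys (frag_list xs) \<subseteq> words xs"
proof (induction xs)
  case (Cons a xs)
  obtain c w where "a = (c, w)" by (cases a)
  with Cons show ?case
    using keys_add[of "frag_cmul c (frag_of w)" "frag_list xs"] keys_cmul[of c "frag_of w"]
    by auto
qed simp

definition act_frag :: "gen \<Rightarrow> (gen list \<Rightarrow>\<^sub>0 int) \<Rightarrow> (gen list \<Rightarrow>\<^sub>0 int)" where
  "act_frag g = frag_extend (\<lambda>w. frag_list (act g w))"

lemma frag_list_act_path: "frag_list (act_path gs xs) = foldr act_frag gs (frag_list xs)"
  unfolding act_path_def
  by (induction gs) (simp_all add: frag_list_linext act_frag_def)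

lemma foldr_act_frag_0: "foldr act_frag gs 0 = 0"
  by (induction gs) (simp_all add: act_frag_def)

lemma foldr_act_frag_add: "foldr act_frag gs (x + y) = foldr act_frag gs x + foldr act_frag gs y"
  by (induction gs) (simp_all add: act_frag_def frag_extend_add)

lemma foldr_act_frag_diff: "foldr act_frag gs (x - y) = foldr act_frag gs x - foldr act_frag gs y"
  by (induction gs) (simp_all add: act_frag_def frag_extend_diff)

lemma foldr_act_frag_cmul: "foldr act_frag gs (frag_cmul c x) = frag_cmul c (foldr act_frag gs x)"
  by (induction gs) (simp_all add: act_frag_def frag_extend_cmul)

lemma keys_foldr_act_frag:
  assumes "Poly_Mapping.keys f \<subseteq> set basis"
  shows "Poly_Mapping.keys (foldr act_frag gs f) \<subseteq> set basis"
proof (induction gs)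
  case (Cons g gs)
  have "Poly_Mapping.keys (frag_list (act g w)) \<subseteq> set basis" if "w \<in> set basis" for w
    using keys_frag_list words_act_subset[OF that] by blast
  with Cons have "(\<Union>w\<in>Poly_Mapping.keys (foldr act_frag gs f).
      Poly_Mapping.keys (frag_list (act g w))) \<subseteq> set basis"
    by (intro UN_least) blast
  then show ?case
    unfolding foldr.simps o_apply act_frag_def[of g] by (rule order_trans[OF keys_frag_extend])
qed (use assms in simp)

definition relator_action :: "combination \<Rightarrow> (gen list \<Rightarrow>\<^sub>0 int) \<Rightarrow> (gen list \<Rightarrow>\<^sub>0 int)" where
  "relator_action r f = (\<Sum>(c, gs)\<leftarrow>r. frag_cmul c (foldr act_frag gs f))"

lemma frag_cmul_diff_right: "frag_cmul c (x - y) = frag_cmul c x - frag_cmul c y"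
  by (intro poly_mapping_eqI) (simp add: lookup_minus right_diff_distrib)

lemma relator_action_diff: "relator_action r (x - y) = relator_action r x - relator_action r y"
  by (induction r)
    (auto simp: relator_action_def foldr_act_frag_diff frag_cmul_diff_right)

lemma frag_list_act_combination:
  "frag_list (act_combination r w) = relator_action r (frag_of w)"
  by (induction r)
    (auto simp: act_combination_def relator_action_def frag_list_act_path foldr_act_frag_cmul)

lemma relator_action_eq_0:
  assumes "Poly_Mapping.keys f \<subseteq> set basis" and r: "r \<in> set relator_list"
  shows "relator_action r f = 0"
  using assms(1)
\<comment> \<open>The generators and differences exhaust the free module on the normal words, so the
  evaluated check on single words is enough.\<close>
proof (induction f rule: frag_induction)
  case zero
  then show ?case
    using relator_action_diff[of r 0 0] by simp
next
  case (one w)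
  with r relators_vanish_basis have "is_null (act_combination r w)"
    by (simp add: relators_vanish_def list_all_iff)
  then show ?case
    by (simp add: is_null_frag_list frag_list_act_combination[symmetric])
next
  case (diff x y)
  then show ?case by (simp add: relator_action_diff)
qed

text \<open>The word applied to the vector that represents the unit, as in the left regular
  representation.\<close>

definition normal_form :: "gen list \<Rightarrow> (gen list \<Rightarrow>\<^sub>0 int)" where
  "normal_form gs = foldr act_frag gs (frag_list (map (\<lambda>v. (1, [Idem v])) vertices))"

lemma normal_form_basis: "w \<in> set basis \<Longrightarrow> normal_form w = frag_of w"
  using all_normal_basis
  by (simp add: normal_form_def frag_list_act_path[symmetric] all_normal_def list_all_iff)

lemma keys_normal_form: "Poly_Mapping.keys (normal_form gs) \<subseteq> set basis"
proof -
  have "words (map (\<lambda>v. (1, [Idem v])) vertices) \<subseteq> set basis"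
    by (auto simp: Idem_in_basis)
  then show ?thesis
    unfolding normal_form_def by (intro keys_foldr_act_frag order_trans[OF keys_frag_list])
qed

text \<open>A left action handles the two-sided ideal: \<open>v\<close> leads into the span of the
  normal words, there the relator acts as zero, and \<open>u\<close> maps zero to zero.\<close>

lemma relator_normal_form:
  assumes "r \<in> set relator_list"
  shows "(\<Sum>(c, gs)\<leftarrow>r. frag_cmul c (normal_form (u @ gs @ v))) = 0"
proof -
  have "(\<Sum>(c, gs)\<leftarrow>r. frag_cmul c (normal_form (u @ gs @ v))) =
      foldr act_frag u (relator_action r (normal_form v))"
    unfolding relator_action_def
    by (induction r)
      (auto simp: foldr_act_frag_0 foldr_act_frag_add foldr_act_frag_cmul normal_form_def)
  with assms show ?thesis
    by (simp add: relator_action_eq_0 keys_normal_form foldr_act_frag_0)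
qed

section \<open>From integral relators to coordinate functionals\<close>

definition free_combination :: "combination \<Rightarrow> (gen word \<Rightarrow>\<^sub>0 'k::field)" where
  "free_combination r = (\<Sum>(c, gs)\<leftarrow>r. Poly_Mapping.single (Word gs) (of_int c))"

lemma relators_subset: "relators \<subseteq> (free_combination ` set relator_list :: (gen word \<Rightarrow>\<^sub>0 'k::field) set)"
proof -
  have v: "v \<in> set vertices" for v
    by (cases v) (simp_all add: vertices_def)
  note simps = free_combination_def var_def mult_single plus_word_def single_one[symmetric]
    zero_word_def single_uminus
  let ?idem = "\<lambda>i j. (1, [Idem i, Idem j]) # (if i = j then [(-1, [Idem i])] else [])"
  have "var (Idem i) * var (Idem j) - (if i = j then var (Idem i) else 0) =
      (free_combination (?idem i j) :: gen word \<Rightarrow>\<^sub>0 'k)" for i j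
    by (simp add: simps)
  moreover have "?idem i j \<in> set relator_list" for i j
    unfolding relator_list_def set_append
    by (rule UnI1) (simp only: set_concat set_map image_image, intro UN_I[where a = i] imageI v)
  ultimately have 1: "{var (Idem i) * var (Idem j) - (if i = j then var (Idem i) else 0) | i j. True}
      \<subseteq> (free_combination ` set relator_list :: (gen word \<Rightarrow>\<^sub>0 'k) set)"
    by blast
  have "var (Idem V1) + var (Idem V2) + var (Idem V3) + var (Idem V4) - 1 =
      (free_combination ((-1, []) # map (\<lambda>v. (1, [Idem v])) vertices) :: gen word \<Rightarrow>\<^sub>0 'k)"
    by (simp add: simps vertices_def)
  moreover have "(-1, []) # map (\<lambda>v. (1, [Idem v])) vertices \<in> set relator_list"
    by (simp add: relator_list_def)
  ultimately have 2: "{var (Idem V1) + var (Idem V2) + var (Idem V3) + var (Idem V4) - 1}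
      \<subseteq> (free_combination ` set relator_list :: (gen word \<Rightarrow>\<^sub>0 'k) set)"
    by blast
  let ?ends = "\<lambda>g. [(1, [Idem (source g), g, Idem (target g)]), (-1, [g])]"
  have "var (Idem (source g)) * var g * var (Idem (target g)) - var g =
      (free_combination (?ends g) :: gen word \<Rightarrow>\<^sub>0 'k)" for g
    by (simp add: simps)
  moreover have "?ends g \<in> set relator_list" for g
    using in_gens[of g] by (simp add: relator_list_def)
  ultimately have 3: "{var (Idem (source g)) * var g * var (Idem (target g)) - var g | g. True}
      \<subseteq> (free_combination ` set relator_list :: (gen word \<Rightarrow>\<^sub>0 'k) set)"
    by blast
  have 4: "free_combination ` set
     [[(1, [X3, X3])], [(1, [X4, X4])], [(1, [X3, G34]), (-1, [G34, X4])],
      [(1, [X4, G43]), (-1, [G43, X3])], [(1, [G12, G21])], [(1, [G21, G12]), (1, [G23, G32])],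
      [(1, [G32, G23, X3]), (1, [X3, G32, G23]), (1, [G34, G43])], [(1, [G43, G34])]]
      \<subseteq> (free_combination ` set relator_list :: (gen word \<Rightarrow>\<^sub>0 'k) set)"
    by (intro image_mono) (auto simp: relator_list_def)
  show ?thesis
    unfolding relators_def using 1 2 3 4
    by (intro Un_least) (simp_all add: simps add.assoc)
qed

text \<open>The linear functional on the free algebra that sends each word to the
  \<open>u\<close>-coordinate of its integral normal form, read in the field.\<close>

definition coef :: "gen list \<Rightarrow> (gen word \<Rightarrow>\<^sub>0 'k::field) \<Rightarrow> 'k" where
  "coef u p = (\<Sum>w\<in>Poly_Mapping.keys p.
     Poly_Mapping.lookup p w * of_int (Poly_Mapping.lookup (normal_form (letters w)) u))"

lemma coef_superset:
  assumes "finite S" "Poly_Mapping.keys p \<subseteq> S"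
  shows "coef u p = (\<Sum>w\<in>S.
    Poly_Mapping.lookup p w * of_int (Poly_Mapping.lookup (normal_form (letters w)) u))"
  unfolding coef_def
  by (rule sum.mono_neutral_left) (use assms in \<open>auto simp: in_keys_iff\<close>)

lemma coef_0 [simp]: "coef u 0 = 0"
  by (simp add: coef_def)

lemma coef_add: "coef u (p + q) = coef u p + coef u q"
proof -
  let ?S = "Poly_Mapping.keys p \<union> Poly_Mapping.keys q"
  have "Poly_Mapping.keys (p + q) \<subseteq> ?S"
    by (rule keys_add)
  then show ?thesis
    by (simp add: coef_superset[of ?S] lookup_add distrib_right sum.distrib)
qed

lemma coef_diff: "coef u (p - q) = coef u p - coef u q"
  using coef_add[of u "p - q" q] by simp

lemma coef_single:
  "coef u (Poly_Mapping.single w c) = c * of_int (Poly_Mapping.lookup (normal_form (letters w)) u)"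
  by (subst coef_superset[of "{w}"]) auto

lemma coef_relator_single:
  assumes "r \<in> set relator_list"
  shows "coef u (Poly_Mapping.single v a * free_combination r * Poly_Mapping.single w b) =
    (0 :: 'k::field)"
proof -
  have "coef u (Poly_Mapping.single v a * free_combination r * Poly_Mapping.single w b) =
      a * b * of_int (Poly_Mapping.lookup
        (\<Sum>(c, gs)\<leftarrow>r. frag_cmul c (normal_form (letters v @ gs @ letters w))) u)" for r
    by (induction r)
      (auto simp: free_combination_def distrib_left distrib_right coef_add coef_single mult_single
        plus_word_def lookup_add)
  then show ?thesis
    using assms by (simp only: relator_normal_form) simp
qed

lemma coef_relator:
  assumes "r \<in> set relator_list"
  shows "coef u (p * free_combination r * q) = (0 :: 'k::field)"
proof (induction p rule: poly_mapping_single_induct)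
  case (add_single v a p)
  have "coef u (Poly_Mapping.single v a * free_combination r * q) = 0"
    by (induction q rule: poly_mapping_single_induct)
      (simp_all add: distrib_left coef_add coef_relator_single[OF assms])
  with add_single show ?case
    by (simp add: distrib_right coef_add)
qed simp

lemma coef_ideal: "p \<in> two_sided_ideal relators \<Longrightarrow> coef u p = (0 :: 'k::field)"
proof (induction rule: two_sided_ideal.induct)
  case (add_multiple p r a b)
  then show ?case
    using relators_subset[where ?'k = 'k] by (auto simp: coef_add coef_relator)
qed simp

text \<open>Since \<open>coef u\<close> kills the ideal, it descends to the quotient. By
  \<open>coord_path\<close> the resulting functionals are dual to the normal words, which is their
  independence.\<close>

lift_definition coord :: "gen list \<Rightarrow> 'k::field Pi_F4 \<Rightarrow> 'k" is coef
proof -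
  fix u and p q :: "gen word \<Rightarrow>\<^sub>0 'k"
  assume "Pi_F4_eq p q"
  then have "coef u (p - q) = 0"
    by (simp add: Pi_F4_eq_def coef_ideal)
  then show "coef u p = coef u q"
    by (simp add: coef_diff)
qed

lemma coord_0 [simp]: "coord u 0 = 0"
  by transfer simp

lemma coord_add: "coord u (x + y) = coord u x + coord u y"
  by transfer (rule coef_add)

lemma coord_scale: "coord u (scale_Pi_F4 c x) = c * coord u x"
proof transfer
  fix u c and p :: "gen word \<Rightarrow>\<^sub>0 'a"
  show "coef u (Poly_Mapping.single 0 c * p) = c * coef u p"
    by (induction p rule: poly_mapping_single_induct)
      (simp_all add: distrib_left coef_add coef_single mult_single)
qed

lemma coord_path:
  assumes "w \<in> set basis"
  shows "coord u (path w) = (if u = w then 1 else (0 :: 'k::field))"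
proof -
  have "coord u (path w :: 'k Pi_F4) = of_int (Poly_Mapping.lookup (normal_form w) u)"
    by transfer (simp add: coef_single)
  then show ?thesis
    by (simp add: normal_form_basis[OF assms] lookup_single_not_eq)
qed

text \<open>Independence of an image set would not exclude that two normal words have the same
  value; counting words instead of values needs this.\<close>

lemma inj_on_path: "inj_on (path :: gen list \<Rightarrow> 'k::field Pi_F4) (set basis)"
proof (rule inj_onI)
  fix v w
  assume vw: "v \<in> set basis" "w \<in> set basis" "(path v :: 'k Pi_F4) = path w"
  then have "coord v (path w :: 'k Pi_F4) = 1"
    using coord_path[OF vw(1), of v, where ?'k = 'k] by simp
  then show "v = w"
    using coord_path[OF vw(2), of v, where ?'k = 'k] by (simp split: if_splits)
qed

lemma coord_expansion: "x = (\<Sum>w\<in>set basis. scale_Pi_F4 (coord w x) (path w))"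
proof -
  have "x \<in> span_Pi_F4 (path ` set basis)"
    by (simp add: span_basis)
  then show ?thesis
  proof (induction rule: Pi_F4.span_induct_alt)
    case (step c y x)
    then obtain v where v: "v \<in> set basis" "y = path v" by blast
    have "(\<Sum>w\<in>set basis. scale_Pi_F4 (coord w y) (path w)) =
        (\<Sum>w\<in>set basis. if v = w then path w else 0)"
      by (rule sum.cong) (simp_all add: v coord_path)
    then have y: "(\<Sum>w\<in>set basis. scale_Pi_F4 (coord w y) (path w)) = y"
      by (simp add: v)
    have "(\<Sum>w\<in>set basis. scale_Pi_F4 (c * coord w y) (path w)) = scale_Pi_F4 c y"
      by (simp only: Pi_F4.scale_scale[symmetric] Pi_F4.scale_sum_right[symmetric] y)
    with step.IH show ?case
      by (simp add: coord_add coord_scale Pi_F4.scale_left_distrib sum.distrib)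
  qed simp
qed

text \<open>Spans of normal words are coordinate subspaces, hence cut out by vanishing
  coordinates.\<close>

lemma span_path_iff:
  assumes "S \<subseteq> set basis"
  shows "(x :: 'k::field Pi_F4) \<in> span_Pi_F4 (path ` S) \<longleftrightarrow> (\<forall>u \<in> set basis - S. coord u x = 0)"
proof
  assume "x \<in> span_Pi_F4 (path ` S)"
  then show "\<forall>u \<in> set basis - S. coord u x = 0"
  proof (induction rule: Pi_F4.span_induct_alt)
    case (step c y x)
    then obtain v where "v \<in> S" "y = path v" by blast
    with assms have "coord u y = 0" if "u \<in> set basis - S" for u
      using that coord_path[of v u, where ?'k = 'k] by auto
    with step.IH show ?case
      by (simp add: coord_add coord_scale)
  qed simp
next
  assume *: "\<forall>u \<in> set basis - S. coord u x = 0"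
  have "scale_Pi_F4 (coord w x) (path w) \<in> span_Pi_F4 (path ` S)" if "w \<in> set basis" for w
    using * that by (cases "w \<in> S")
      (auto intro: Pi_F4.span_scale Pi_F4.span_base simp: Pi_F4.span_zero)
  then have "(\<Sum>w\<in>set basis. scale_Pi_F4 (coord w x) (path w)) \<in> span_Pi_F4 (path ` S)"
    by (rule Pi_F4.span_sum)
  then show "x \<in> span_Pi_F4 (path ` S)"
    using coord_expansion[of x] by simp
qed

text \<open>This fails for spans of arbitrary sets; it holds here because all generators belong to
  one basis. It lets the corner condition and the bidegree condition be imposed together.\<close>

lemma span_path_Int:
  assumes "S \<subseteq> set basis" "T \<subseteq> set basis"
  shows "span_Pi_F4 (path ` S) \<inter> span_Pi_F4 (path ` T) =
    (span_Pi_F4 (path ` (S \<inter> T)) :: 'k::field Pi_F4 set)"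
proof -
  have "S \<inter> T \<subseteq> set basis" using assms by blast
  from span_path_iff[OF assms(1)] span_path_iff[OF assms(2)] span_path_iff[OF this]
  show ?thesis by blast
qed

lemma dim_path:
  assumes "S \<subseteq> set basis"
  shows "dim_Pi_F4 (path ` S :: 'k::field Pi_F4 set) = card S"
proof -
  have "Pi_F4.independent (path ` S :: 'k Pi_F4 set)"
    unfolding Pi_F4.dependent_def
  proof clarify
    fix w
    assume w: "w \<in> S" "(path w :: 'k Pi_F4) \<in> span_Pi_F4 (path ` S - {path w})"
    have "span_Pi_F4 (path ` S - {path w}) \<subseteq> (span_Pi_F4 (path ` (S - {w})) :: 'k Pi_F4 set)"
      by (rule Pi_F4.span_mono) blast
    with w(2) have "coord w (path w :: 'k Pi_F4) = 0"
      using span_path_iff[of "S - {w}" "path w :: 'k Pi_F4"] w(1) assms by blast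
    with coord_path[of w w, where ?'k = 'k] w(1) assms show False by auto
  qed
  then have "dim_Pi_F4 (path ` S :: 'k Pi_F4 set) = card (path ` S :: 'k Pi_F4 set)"
    by (rule Pi_F4.dim_eq_card_independent)
  then show ?thesis
    by (simp add: card_image inj_on_subset[OF inj_on_path assms])
qed

section \<open>Components and degree counts\<close>

lemma idem_path_idem:
  assumes "w \<in> set basis"
  shows "path [Idem i] * path w * path [Idem j] =
    (if source (hd w) = i \<and> target (last w) = j then path w else (0 :: 'k::field Pi_F4))"
proof -
  have w: "w \<noteq> []"
    using nonempty_basis assms by (auto simp: list_all_iff)
  have "path [Idem i] * path w = (if source (hd w) = i then path w else (0 :: 'k Pi_F4))"
    using w idem_mult_path[of i "hd w" "tl w", where ?'k = 'k] by auto
  moreover have "path w * path [Idem j] = (if target (last w) = j then path w else (0 :: 'k Pi_F4))"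
    using w path_mult_idem[of "butlast w" "last w" j, where ?'k = 'k] by simp
  ultimately show ?thesis by simp
qed

text \<open>Multiplication by the two idempotents fixes or kills each normal word, so it is a
  coordinate projection, and the corner is its image.\<close>

lemma corner_eq_span:
  "(corner i j :: 'k::field Pi_F4 set) =
    span_Pi_F4 (path ` {w \<in> set basis. source (hd w) = i \<and> target (last w) = j})"
  (is "_ = span_Pi_F4 (path ` ?S)")
proof
  show "(corner i j :: 'k Pi_F4 set) \<subseteq> span_Pi_F4 (path ` ?S)"
  proof
    fix y :: "'k Pi_F4"
    assume "y \<in> corner i j"
    then obtain x where y: "y = path [Idem i] * x * path [Idem j]"
      by (auto simp: corner_def idem_Pi_F4_def)
    have "(x :: 'k Pi_F4) \<in> span_Pi_F4 (path ` set basis)"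
      by (simp add: span_basis)
    then have "path [Idem i] * x \<in> span_Pi_F4 ((*) (path [Idem i]) ` path ` set basis)"
      by (rule span_mult_left[rotated]) (auto intro: Pi_F4.span_base)
    then show "y \<in> span_Pi_F4 (path ` ?S)"
      unfolding y
      by (rule span_mult_right[rotated])
        (auto simp: idem_path_idem intro!: Pi_F4.span_zero intro: Pi_F4.span_base[OF imageI])
  qed
  show "span_Pi_F4 (path ` ?S) \<subseteq> (corner i j :: 'k Pi_F4 set)"
  proof
    fix x :: "'k Pi_F4"
    assume "x \<in> span_Pi_F4 (path ` ?S)"
    then have "path [Idem i] * x * path [Idem j] = x"
      by (induction rule: Pi_F4.span_induct_alt)
        (auto simp: distrib_left distrib_right scale_Pi_F4_mult_left scale_Pi_F4_mult_right
          idem_path_idem)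
    then show "x \<in> corner i j"
      unfolding corner_def idem_Pi_F4_def by (metis (mono_tags, lifting) mem_Collect_eq)
  qed
qed

text \<open>As \<open>P\<close> depends on the bidegree alone, the normal words to which a word
  reduces satisfy \<open>P\<close> along with it.\<close>

lemma span_graded:
  assumes "\<And>v w. bidegree v = bidegree w \<Longrightarrow> P v \<longleftrightarrow> P w"
  shows "span_Pi_F4 {path w | w. P w} =
    (span_Pi_F4 (path ` {w \<in> set basis. P w}) :: 'k::field Pi_F4 set)"
proof
  have "path w \<in> (span_Pi_F4 (path ` {u \<in> set basis. P u}) :: 'k Pi_F4 set)" if "P w" for w
    using path_in_span_bidegree[of w, where ?'k = 'k]
    by (rule subsetD[OF Pi_F4.span_mono, rotated]) (use that assms in blast)
  then show "span_Pi_F4 {path w | w. P w} \<subseteq>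
      (span_Pi_F4 (path ` {w \<in> set basis. P w}) :: 'k Pi_F4 set)"
    by (intro Pi_F4.span_minimal) (auto simp: Pi_F4.subspace_span)
  show "span_Pi_F4 (path ` {w \<in> set basis. P w}) \<subseteq>
      (span_Pi_F4 {path w | w. P w} :: 'k Pi_F4 set)"
    by (rule Pi_F4.span_mono) blast
qed

lemma bidegree_component_eq_span:
  "(bidegree_component a b :: 'k::field Pi_F4 set) =
    span_Pi_F4 (path ` {w \<in> set basis. bidegree w = (a, b)})"
proof -
  have "{word_Pi_F4 w | w. path_length w = a \<and> xdegree w = b} =
      ({path w | w. bidegree w = (a, b)} :: 'k Pi_F4 set)"
    unfolding bidegree_def by (auto, metis word.collapse)
  then show ?thesis
    unfolding bidegree_component_def by (simp add: span_graded)
qed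

lemma length_component_eq_span:
  "(length_component n :: 'k::field Pi_F4 set) =
    span_Pi_F4 (path ` {w \<in> set basis. fst (bidegree w) = n})"
proof -
  have "{word_Pi_F4 w | w. path_length w = n} =
      ({path w | w. fst (bidegree w) = n} :: 'k Pi_F4 set)"
    unfolding bidegree_def by (auto, metis word.collapse)
  then show ?thesis
    unfolding length_component_def by (simp add: span_graded)
qed

text \<open>Twice the \<open>x\<close>-degree, an integer, keeps rational arithmetic out of the evaluation.\<close>

fun gen_double_degree :: "gen \<Rightarrow> nat" where
  "gen_double_degree X3 = 2"
| "gen_double_degree X4 = 2"
| "gen_double_degree G34 = 1"
| "gen_double_degree G43 = 1"
| "gen_double_degree _ = 0"

definition degree_pair :: "gen list \<Rightarrow> nat \<times> nat" where
  "degree_pair w = (sum_list (map gen_length w), sum_list (map gen_double_degree w))"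

lemma bidegree_eq_degree_pair:
  "bidegree w = (fst (degree_pair w), of_nat (snd (degree_pair w)) / 2)"
proof -
  have *: "gen_xdegree g = of_nat (gen_double_degree g) / 2" for g
    by (cases g) simp_all
  then have "sum_list (map gen_xdegree w) = of_nat (sum_list (map gen_double_degree w)) / 2"
    by (induction w)
      (simp_all only: * list.map sum_list.Nil sum_list.Cons of_nat_0 of_nat_add div_0 add_divide_distrib)
  then show ?thesis
    by (simp add: bidegree_def degree_pair_def path_length_def xdegree_def)
qed

definition degree_list :: "gen list list \<Rightarrow> vertex \<times> vertex \<Rightarrow> (nat \<times> nat) list" where
  "degree_list bs = (\<lambda>(i, j).
     map degree_pair (filter (\<lambda>w. source (hd w) = i \<and> target (last w) = j) bs))"

definition degree_polynomial :: "(nat \<times> nat) list \<Rightarrow> (nat \<times> rat \<Rightarrow>\<^sub>0 nat)" where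
  "degree_polynomial ds = (\<Sum>(a, b)\<leftarrow>ds. Poly_Mapping.single (a, of_nat b / 2) 1)"

lemma lookup_degree_polynomial:
  "Poly_Mapping.lookup (degree_polynomial (map degree_pair ws)) d =
    length (filter (\<lambda>w. bidegree w = d) ws)"
  by (induction ws)
    (auto simp: degree_polynomial_def lookup_add lookup_single bidegree_eq_degree_pair
      case_prod_unfold when_def)

lemma card_filter_basis: "card {w \<in> set basis. P w} = length (filter P basis)"
  using distinct_card[of "filter P basis"] distinct_basis by simp

lemma hilbert_series_eq:
  "hilbert_series TYPE('k::field) i j =
    Poly_Mapping.lookup (degree_polynomial (degree_list basis (i, j)))"
proof (rule ext)
  fix d :: "nat \<times> rat"
  obtain a b where d: "d = (a, b)" by (cases d)
  let ?S = "{w \<in> set basis. source (hd w) = i \<and> target (last w) = j}"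
  have "hilbert_series TYPE('k) i j d =
      dim_Pi_F4 (path ` (?S \<inter> {w \<in> set basis. bidegree w = d}) :: 'k Pi_F4 set)"
    by (simp add: hilbert_series_def d corner_eq_span bidegree_component_eq_span span_path_Int)
  also have "\<dots> = card {w \<in> set basis. source (hd w) = i \<and> target (last w) = j \<and> bidegree w = d}"
    by (subst dim_path) (auto intro!: arg_cong[of _ _ card])
  also have "\<dots> = Poly_Mapping.lookup (degree_polynomial (degree_list basis (i, j))) d"
    by (simp add: card_filter_basis degree_list_def lookup_degree_polynomial)
  finally show "hilbert_series TYPE('k) i j d = \<dots>" .
qed

lemma total_hilbert_series_nth:
  "fps_nth (total_hilbert_series TYPE('k::field)) n =
    length (filter (\<lambda>w. fst (degree_pair w) = n) basis)"
proof -
  have "fps_nth (total_hilbert_series TYPE('k)) n = card {w \<in> set basis. fst (bidegree w) = n}"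
    by (simp add: total_hilbert_series_def length_component_eq_span dim_path)
  then show ?thesis
    by (simp add: card_filter_basis bidegree_eq_degree_pair)
qed

text \<open>The rows run through the corners \<open>(V1, V1)\<close>, \<open>(V1, V2)\<close>, ...,
  \<open>(V4, V4)\<close>; a pair \<open>(a, b)\<close> stands for the monomial t^a s^(b/2).\<close>

lemma degree_table:
  "map (degree_list basis) (List.product vertices vertices) =
     [[(0, 0), (4, 2), (6, 4), (10, 6)],
      [(1, 0), (3, 2), (5, 2), (5, 4), (7, 4), (9, 6)],
      [(2, 0), (2, 2), (4, 2), (4, 4), (6, 2), (6, 4), (8, 4), (8, 6)],
      [(3, 1), (3, 3), (7, 3), (7, 5)],
      [(1, 0), (3, 2), (5, 2), (5, 4), (7, 4), (9, 6)],
      [(0, 0), (2, 0), (2, 2), (4, 2), (4, 2), (4, 4), (6, 2), (6, 4), (6, 4), (8, 4), (8,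
       6), (10, 6)],
      [(1, 0), (1, 2), (3, 0), (3, 2), (3, 2), (3, 4), (5, 2), (5, 2), (5, 4), (5, 4), (7,
       2), (7, 4), (7, 4), (7, 6), (9, 4), (9, 6)],
      [(2, 1), (2, 3), (4, 1), (4, 3), (6, 3), (6, 5), (8, 3), (8, 5)],
      [(2, 0), (2, 2), (4, 2), (4, 4), (6, 2), (6, 4), (8, 4), (8, 6)],
      [(1, 0), (1, 2), (3, 0), (3, 2), (3, 2), (3, 4), (5, 2), (5, 2), (5, 4), (5, 4), (7,
       2), (7, 4), (7, 4), (7, 6), (9, 4), (9, 6)],
      [(0, 0), (0, 2), (2, 0), (2, 2), (2, 2), (2, 4), (4, 0), (4, 2), (4, 2), (4, 2), (4,
       4), (4, 4), (6, 2), (6, 2), (6, 4), (6, 4), (6, 4), (6, 6), (8, 2), (8, 4), (8, 4),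
       (8, 6), (10, 4), (10, 6)],
      [(1, 1), (1, 3), (3, 1), (3, 3), (5, 1), (5, 3), (5, 3), (5, 5), (7, 3), (7, 5), (9,
       3), (9, 5)],
      [(3, 1), (3, 3), (7, 3), (7, 5)],
      [(2, 1), (2, 3), (4, 1), (4, 3), (6, 3), (6, 5), (8, 3), (8, 5)],
      [(1, 1), (1, 3), (3, 1), (3, 3), (5, 1), (5, 3), (5, 3), (5, 5), (7, 3), (7, 5), (9,
       3), (9, 5)],
      [(0, 0), (0, 2), (4, 2), (4, 4), (6, 2), (6, 4), (10, 4), (10, 6)]]"
  by code_simp

definition length_counts :: "gen list list \<Rightarrow> nat list" where
  "length_counts bs =
     (let ls = map (\<lambda>w. fst (degree_pair w)) bs in map (\<lambda>n. length (filter (\<lambda>l. l = n) ls)) [0..<11])"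

definition length_bounded :: "gen list list \<Rightarrow> bool" where
  "length_bounded bs = list_all (\<lambda>w. fst (degree_pair w) \<le> 10) bs"

lemma length_counts_basis: "length_counts basis = [6, 10, 14, 18, 20, 20, 20, 18, 14, 10, 6]"
  by code_simp

text \<open>The counts cover the lengths 0 to 10 only; this bound makes all later coefficients
  zero.\<close>

lemma length_bounded_basis: "length_bounded basis"
  by code_simp

lemma single_power:
  "Poly_Mapping.single (a, b) 1 ^ n =
    (Poly_Mapping.single (n * a, of_nat n * b) 1 :: nat \<times> 'b::semiring_1 \<Rightarrow>\<^sub>0 'c::semiring_1)"
  by (induction n) (simp_all add: mult_single zero_prod_def[symmetric] distrib_right)

lemma total_hilbert_series_eq:
  "total_hilbert_series TYPE('k::field) =
     6 + 10 * fps_X + 14 * fps_X^2 + 18 * fps_X^3 + 20 * fps_X^4 + 20 * fps_X^5 +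
     20 * fps_X^6 + 18 * fps_X^7 + 14 * fps_X^8 + 10 * fps_X^9 + 6 * fps_X^10"
proof (rule fps_ext)
  fix n :: nat
  have small: "n \<le> 10 \<Longrightarrow> n \<in> {0, 1, 2, 3, 4, 5, 6, 7, 8, 9, 10}"
    by simp presburger
  have "fps_nth (total_hilbert_series TYPE('k)) n =
      (if n \<le> 10 then [6, 10, 14, 18, 20, 20, 20, 18, 14, 10, 6] ! n else 0)"
  proof (cases "n \<le> 10")
    case True
    then have "length_counts basis ! n = length (filter (\<lambda>w. fst (degree_pair w) = n) basis)"
      by (simp add: length_counts_def Let_def filter_map o_def del: upt_Suc)
    with True show ?thesis
      by (simp only: total_hilbert_series_nth length_counts_basis if_True)
  next
    case False
    with length_bounded_basis have "filter (\<lambda>w. fst (degree_pair w) = n) basis = []"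
      by (auto simp: length_bounded_def list_all_iff filter_empty_conv)
    with False show ?thesis
      by (simp add: total_hilbert_series_nth)
  qed
  also have "\<dots> = fps_nth (6 + 10 * fps_X + 14 * fps_X^2 + 18 * fps_X^3 + 20 * fps_X^4 +
     20 * fps_X^5 + 20 * fps_X^6 + 18 * fps_X^7 + 14 * fps_X^8 + 10 * fps_X^9 + 6 * fps_X^10) n"
  proof (cases "n \<le> 10")
    case True
    from small[OF True] show ?thesis
      by (elim insertE emptyE; simp add: numeral_fps_const fps_X_power_nth)
  next
    case False
    then show ?thesis
      by (simp add: numeral_fps_const fps_X_power_nth)
  qed
  finally show "fps_nth (total_hilbert_series TYPE('k)) n = \<dots>" .
qed

theorem proposition5p12:
  fixes h :: "vertex \<Rightarrow> vertex \<Rightarrow> nat \<times> rat \<Rightarrow> nat"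
    and t s s' :: "nat \<times> rat \<Rightarrow>\<^sub>0 nat"
  defines "h \<equiv> hilbert_series TYPE('k::field)"
    and "t \<equiv> t_var" and "s \<equiv> s_var" and "s' \<equiv> s_half"
  shows
    "(\<exists>B :: 'k Pi_F4 set. finite B \<and> span_Pi_F4 B = UNIV) \<and>
     h V1 V1 = h_entry (1 + t^6 * s^2) \<and>
     h V1 V2 = h_entry (t * (1 + t^2 * s + t^4 * s^2)) \<and>
     h V1 V3 = h_entry (t^2 * (1 + s) * (1 + t^2 * s)) \<and>
     h V1 V4 = h_entry (t^3 * s' * (1 + s)) \<and>
     h V2 V2 = h_entry ((1 + t^2) * (1 + t^2 * s + t^4 * s^2)) \<and>
     h V2 V3 = h_entry (t * (1 + s) * (1 + t^2) * (1 + t^2 * s)) \<and>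
     h V2 V4 = h_entry (t^2 * s' * (1 + s) * (1 + t^2)) \<and>
     h V3 V3 = h_entry ((1 + s) * (1 + t^2 + t^4) * (1 + t^2 * s)) \<and>
     h V3 V4 = h_entry (t * s' * (1 + s) * (1 + t^2 + t^4)) \<and>
     h V4 V4 = h_entry ((1 + s) * (1 + t^6 * s)) \<and>
     (\<forall>i j. h j i = h i j) \<and>
     total_hilbert_series TYPE('k) =
       6 + 10 * fps_X + 14 * fps_X^2 + 18 * fps_X^3 + 20 * fps_X^4 + 20 * fps_X^5 +
       20 * fps_X^6 + 18 * fps_X^7 + 14 * fps_X^8 + 10 * fps_X^9 + 6 * fps_X^10"
proof (intro conjI)
  \<comment> \<open>Injectivity of the list constructor splits the table into sixteen equations, one
    for each corner.\<close>
  note degree_lists = degree_table[simplified vertices_def product.simps list.map append.simps list.inject simp_thms]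
  have h: "h i j = Poly_Mapping.lookup (degree_polynomial (degree_list basis (i, j)))" for i j
    unfolding h_def by (rule hilbert_series_eq)
  \<comment> \<open>The constant term comes from the table as a monomial with exponent
    \<open>(0, 0)\<close> but from the formulas as \<open>1\<close>.\<close>
  have one: "Poly_Mapping.single (0, 0) 1 = (1 :: nat \<times> rat \<Rightarrow>\<^sub>0 nat)"
    by (simp add: zero_prod_def[symmetric] del: One_nat_def)
  note entry = h h_entry_def degree_lists degree_polynomial_def t_def s_def s'_def t_var_def
    s_var_def s_half_def single_power mult_single distrib_left distrib_right one
  show "\<exists>B :: 'k Pi_F4 set. finite B \<and> span_Pi_F4 B = UNIV"
    using span_basis[where ?'k = 'k] by (intro exI[of _ "path ` set basis"]) simp
  \<comment> \<open>In this and the next nine equations both sides expand into sums of monomials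
    with coefficient 1, which agree up to order. The deleted rules would replace numerals in the
    exponents by successors.\<close>
  show "h V1 V1 = h_entry (1 + t^6 * s^2)"
    by (simp add: entry del: One_nat_def add_2_eq_Suc add_2_eq_Suc'; simp add: add_ac)
  show "h V1 V2 = h_entry (t * (1 + t^2 * s + t^4 * s^2))"
    by (simp add: entry del: One_nat_def add_2_eq_Suc add_2_eq_Suc'; simp add: add_ac)
  show "h V1 V3 = h_entry (t^2 * (1 + s) * (1 + t^2 * s))"
    by (simp add: entry del: One_nat_def add_2_eq_Suc add_2_eq_Suc'; simp add: add_ac)
  show "h V1 V4 = h_entry (t^3 * s' * (1 + s))"
    by (simp add: entry del: One_nat_def add_2_eq_Suc add_2_eq_Suc'; simp add: add_ac)
  show "h V2 V2 = h_entry ((1 + t^2) * (1 + t^2 * s + t^4 * s^2))"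
    by (simp add: entry del: One_nat_def add_2_eq_Suc add_2_eq_Suc'; simp add: add_ac)
  show "h V2 V3 = h_entry (t * (1 + s) * (1 + t^2) * (1 + t^2 * s))"
    by (simp add: entry del: One_nat_def add_2_eq_Suc add_2_eq_Suc'; simp add: add_ac)
  show "h V2 V4 = h_entry (t^2 * s' * (1 + s) * (1 + t^2))"
    by (simp add: entry del: One_nat_def add_2_eq_Suc add_2_eq_Suc'; simp add: add_ac)
  show "h V3 V3 = h_entry ((1 + s) * (1 + t^2 + t^4) * (1 + t^2 * s))"
    by (simp add: entry del: One_nat_def add_2_eq_Suc add_2_eq_Suc'; simp add: add_ac)
  show "h V3 V4 = h_entry (t * s' * (1 + s) * (1 + t^2 + t^4))"
    by (simp add: entry del: One_nat_def add_2_eq_Suc add_2_eq_Suc'; simp add: add_ac)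
  show "h V4 V4 = h_entry ((1 + s) * (1 + t^6 * s))"
    by (simp add: entry del: One_nat_def add_2_eq_Suc add_2_eq_Suc'; simp add: add_ac)
  show "\<forall>i j. h j i = h i j"
  proof (intro allI)
    fix i j
    show "h j i = h i j"
      by (cases i; cases j) (simp_all add: h degree_lists degree_polynomial_def add_ac
        del: One_nat_def)
  qed
  show "total_hilbert_series TYPE('k) =
       6 + 10 * fps_X + 14 * fps_X^2 + 18 * fps_X^3 + 20 * fps_X^4 + 20 * fps_X^5 +
       20 * fps_X^6 + 18 * fps_X^7 + 14 * fps_X^8 + 10 * fps_X^9 + 6 * fps_X^10"
    by (rule total_hilbert_series_eq)
qed

end
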